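(* Let $e$, $f$, $p>1$, $q>1$, $r>2$, $u>1$ and $v>1$ be positive integers, and let $E=ep^2q^4r^8$. Then the continued fraction $$[0;\overline{r-1,1,q-1,r,p-1,1,r-1,q-1,1,r-1,eu^n-1,1,r-2,1,q-1,r-1,1,p-1,r,q-1,1,r-2,1,fv^n-1}]_{n=1}^{\infty}$$ equals $$\frac{1}{pq^2r^4}+\frac{1}{qr^2}+\frac1r+\left(\frac{1}{Eu}-\frac{1}{E^2fu^2v+E}\right)\frac{\displaystyle\sum_{n=0}^{\infty}\frac{(Ef)^{-n}(uv)^{-n(n+3)/2}}{\left(\frac{1}{uv};\frac{1}{uv}\right)_n\left(-\frac{1}{Efu^3v^2};\frac{1}{uv}\right)_n}}{\displaystyle\sum_{n=0}^{\infty}\frac{(Ef)^{-n}(uv)^{-n(n+1)/2}}{\left(\frac{1}{uv};\frac{1}{uv}\right)_n\left(-\frac{1}{Efu^2v};\frac{1}{uv}\right)_n}}.$$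
   Context: $[0;x_1,x_2,x_3,\dots]$ denotes the value (limit of convergents) of the continued fraction $\cfrac{1}{x_1+\cfrac{1}{x_2+\cfrac{1}{x_3+\cdots}}}$. The notation $[0;\overline{f_1(n),\dots,f_k(n)}]_{n=1}^\infty$ means that the partial quotients are the blocks $f_1(n),\dots,f_k(n)$ concatenated for $n=1,2,3,\dots$; here each block has length $24$. Finally $(z;t)_0=1$ and $(z;t)_n=\prod_{k=0}^{n-1}(1-zt^k)$ for $n\ge1$.
   Formalization: The printed identity is false for all parameters; the quotient of the two sums should multiply only 1/(E^2fu^2v+E), not the whole bracket, so the proved value has 1/(Eu) - (1/(E^2fu^2v+E))·(quotient of the sums) as its last summand. *)

theory Defs
  imports "HOL-Analysis.Analysis"
begin

(* Finite continued fraction [0; x1, ..., xk] = 1/(x1 + 1/(x2 + ... + 1/xk)). *)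

primrec cf_fin :: "int list \<Rightarrow> real" where
  "cf_fin [] = 0"
| "cf_fin (a # as) = 1 / (of_int a + cf_fin as)"

(* The partial quotients are indexed from 0, so x k is the (k+1)-st one. *)

definition cf_convergent :: "(nat \<Rightarrow> int) \<Rightarrow> nat \<Rightarrow> real" where
  "cf_convergent x k = cf_fin (map x [0..<k])"

definition cf_has_value :: "(nat \<Rightarrow> int) \<Rightarrow> real \<Rightarrow> bool" where
  "cf_has_value x l \<longleftrightarrow> cf_convergent x \<longlonglongrightarrow> l"

(* The sequence B 1 @ B 2 @ B 3 @ ...; meaningful only if every B n (n >= 1) has length L > 0. *)

definition concat_blocks :: "nat \<Rightarrow> (nat \<Rightarrow> 'a list) \<Rightarrow> nat \<Rightarrow> 'a" where
  "concat_blocks L B k = B (k div L + 1) ! (k mod L)"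

definition q_poch :: "real \<Rightarrow> real \<Rightarrow> nat \<Rightarrow> real" where
  "q_poch z t n = (\<Prod>k<n. 1 - z * t ^ k)"

end

(*
  Absorbing the partial quotients 1 by [a - 1, 1, b - 1 + s] = a - 1/(b + s), the part of a block
  before e u^n - 1 becomes a word w with convergent
  c = P/Q = 1/(p q^2 r^4) + 1/(q r^2) + 1/r, Q = p q^2 r^4, and the part after it becomes the
  reversal of w with a sign; the two foldings cancel the denominator ratios and leave
    [0; B_n, x] = c + 1/(Q^2 e u^n + 1/(f v^n + (x - c))).
  With E = e Q^2 the value minus c is therefore [0; E u, f v, E u^2, f v^2, ...].  That continued
  fraction is evaluated by the three-term contiguity relation of the q-series
  S(l, z) = sum_n l^n t^(n(n-1)/2) / ((t;t)_n (-z;t)_n), t = 1/(uv), under (l, z) -> (l t, z t).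
  Since all partial quotients are at least 1, the Moebius maps of the blocks contract by a factor
  1/4 every two steps, so a bounded exact sequence of tails forces convergence to the right limit.
*)

theory Submission
  imports Defs
begin

section \<open>Finite continued fractions as contracting maps of their tail\<close>

text \<open>The argument \<open>y\<close> stands for the fraction behind the last quotient, so every
  value of an infinite fraction is a value of this map, and \<open>y = 0\<close> gives the
  convergent.\<close>

primrec cf_with_tail :: "int list \<Rightarrow> real \<Rightarrow> real" where
  "cf_with_tail [] y = y"
| "cf_with_tail (a # as) y = 1 / (of_int a + cf_with_tail as y)"

lemma cf_fin_eq_cf_with_tail: "cf_fin as = cf_with_tail as 0"
  by (induction as) auto

lemma cf_with_tail_append:
  "cf_with_tail (as @ bs) y = cf_with_tail as (cf_with_tail bs y)"
  by (induction as) auto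

lemma cf_with_tail_nonneg:
  assumes "\<forall>a\<in>set as. 1 \<le> a" "0 \<le> y"
  shows "0 \<le> cf_with_tail as y"
  using assms by (induction as) auto

lemma cf_with_tail_le_1:
  assumes "\<forall>a\<in>set as. 1 \<le> a" "0 \<le> y" "as \<noteq> []"
  shows "cf_with_tail as y \<le> 1"
proof (cases as)
  case (Cons a bs)
  then have "0 \<le> cf_with_tail bs y" using assms cf_with_tail_nonneg[of bs y] by auto
  moreover have "1 \<le> real_of_int a" using Cons assms by auto
  ultimately show ?thesis using Cons by (auto simp: divide_simps)
qed (use assms in auto)

text \<open>Two steps form a Moebius map of determinant 1, so the values differ by exactly
  \<open>(s - t) / (g * h)\<close>, and both denominators are at least 2. A single step can have
  slope -1 (at \<open>a = 1\<close> and tail 0), hence the pairing.\<close>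

lemma two_step_contraction:
  fixes a b s t :: real
  assumes "1 \<le> a" "1 \<le> b" "0 \<le> s" "0 \<le> t"
  shows "\<bar>1 / (a + 1 / (b + s)) - 1 / (a + 1 / (b + t))\<bar> \<le> \<bar>s - t\<bar> / 4"
proof -
  define g h where "g = a * (b + s) + 1" and "h = a * (b + t) + 1"
  have ab: "1 * 1 \<le> a * (b + s)" "1 * 1 \<le> a * (b + t)"
    by (rule mult_mono; use assms in linarith)+
  then have gh: "2 \<le> g" "2 \<le> h" by (auto simp: g_def h_def)
  have s: "1 / (a + 1 / (b + s)) = (b + s) / g" "1 / (a + 1 / (b + t)) = (b + t) / h"
    using assms by (auto simp: g_def h_def divide_simps algebra_simps)
  have "(b + s) / g - (b + t) / h = (s - t) / (g * h)"
    using gh by (simp add: divide_simps) (simp add: g_def h_def algebra_simps)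
  then have "\<bar>1 / (a + 1 / (b + s)) - 1 / (a + 1 / (b + t))\<bar> = \<bar>s - t\<bar> / (g * h)"
    unfolding s using gh by (simp add: abs_mult)
  also have "\<dots> \<le> \<bar>s - t\<bar> / (2 * 2)"
    by (rule divide_left_mono) (use gh mult_mono[of 2 g 2 h] in auto)
  finally show ?thesis by simp
qed

text \<open>Quotients are consumed in pairs; one left over contributes the factor 1, since both
  values lie in [0, 1].\<close>

lemma cf_with_tail_contraction:
  assumes "\<forall>a\<in>set as. 1 \<le> a" "0 \<le> y" "y \<le> 1" "0 \<le> y'" "y' \<le> 1"
  shows "\<bar>cf_with_tail as y - cf_with_tail as y'\<bar> \<le> (1 / 4) ^ (length as div 2)"
  using assms(1)
proof (induction as rule: induct_list012)
  case 1
  then show ?case using assms by auto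
next
  case (2 a)
  have "0 \<le> cf_with_tail [a] y" "0 \<le> cf_with_tail [a] y'"
    "cf_with_tail [a] y \<le> 1" "cf_with_tail [a] y' \<le> 1"
    using 2 assms by (intro cf_with_tail_nonneg cf_with_tail_le_1; simp)+
  then have "\<bar>cf_with_tail [a] y - cf_with_tail [a] y'\<bar> \<le> 1" by linarith
  then show ?case by simp
next
  case (3 a b bs)
  have "\<bar>cf_with_tail (a # b # bs) y - cf_with_tail (a # b # bs) y'\<bar>
      \<le> \<bar>cf_with_tail bs y - cf_with_tail bs y'\<bar> / 4"
    unfolding cf_with_tail.simps
    using 3 assms by (intro two_step_contraction cf_with_tail_nonneg) auto
  with 3 show ?case by auto
qed

section \<open>Convergence from an exact sequence of tails\<close>

text \<open>The convergent and \<open>l\<close> are values of the same map at \<open>0\<close> and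
  at some \<open>y\<close> in [0, 1], so the contraction bounds their distance by a null
  sequence.\<close>

lemma cf_has_value_if_tails:
  assumes "\<And>k. 1 \<le> x k"
    and "\<And>k. \<exists>y. 0 \<le> y \<and> y \<le> 1 \<and> l = cf_with_tail (map x [0..<k]) y"
  shows "cf_has_value x l"
proof -
  have bound: "norm (cf_convergent x k - l) \<le> (1 / 4) ^ (k div 2)" for k
  proof -
    obtain y where "0 \<le> y" "y \<le> 1" "l = cf_with_tail (map x [0..<k]) y"
      using assms(2) by blast
    then show ?thesis
      using cf_with_tail_contraction[of "map x [0..<k]" 0 y] assms(1)
      by (simp add: cf_convergent_def cf_fin_eq_cf_with_tail)
  qed
  have "filterlim (\<lambda>k::nat. k div 2) at_top sequentially"
    unfolding filterlim_at_top eventually_sequentially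
  proof
    fix Z :: nat
    show "\<exists>N. \<forall>n\<ge>N. Z \<le> n div 2" by (rule exI[of _ "2 * Z"]) auto
  qed
  then have "(\<lambda>k. (1 / 4 :: real) ^ (k div 2)) \<longlonglongrightarrow> 0"
    by (rule filterlim_compose[rotated]) (simp add: LIMSEQ_power_zero)
  then have "(\<lambda>k. cf_convergent x k - l) \<longlonglongrightarrow> 0"
    by (rule Lim_null_comparison[rotated]) (simp add: bound del: real_norm_def)
  then show ?thesis
    unfolding cf_has_value_def using LIM_zero_cancel by blast
qed

lemma map_concat_blocks:
  assumes "length (B (Suc n)) = L"
  shows "map (concat_blocks L B) [L * n..<L * Suc n] = B (Suc n)"
  using assms by (intro nth_equalityI) (auto simp: concat_blocks_def)

text \<open>Consistency of \<open>X\<close> across whole blocks suffices: the tail at a position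
  inside a block arises by pulling \<open>X n\<close> back from the end of that block.\<close>

lemma cf_has_value_concat_blocks:
  assumes L: "0 < L" and len: "\<And>n. length (B (Suc n)) = L"
    and pos: "\<And>n. \<forall>a\<in>set (B (Suc n)). 1 \<le> a"
    and X: "\<And>n. 0 \<le> X n" "\<And>n. X n = cf_with_tail (B (Suc n)) (X (Suc n))"
  shows "cf_has_value (concat_blocks L B) (X 0)"
proof (rule cf_has_value_if_tails)
  let ?x = "concat_blocks L B"
  show x1: "1 \<le> ?x k" for k
  proof -
    have "B (Suc (k div L)) ! (k mod L) \<in> set (B (Suc (k div L)))"
      using L by (intro nth_mem) (simp add: len)
    then show ?thesis using pos by (simp add: concat_blocks_def)
  qed
  fix k
  have start: "X 0 = cf_with_tail (map ?x [0..<L * n]) (X n)" for n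
  proof (induction n)
    case (Suc n)
    have "[0..<L * Suc n] = [0..<L * n] @ [L * n..<L * Suc n]"
      using upt_add_eq_append[of 0 "L * n" L] by (simp add: add.commute)
    then show ?case
      using Suc X(2)[of n] map_concat_blocks[of B n L, OF len]
      by (simp only: map_append cf_with_tail_append)
  qed simp
  \<comment> \<open>The block containing position \<open>k\<close> ends strictly beyond
    \<open>k\<close>, so at least one quotient is applied to \<open>X n\<close>. This yields
    \<open>?y \<le> 1\<close> without an upper bound on \<open>X n\<close>.\<close>
  define n where "n = Suc (k div L)"
  have k: "k < L * n"
    using dividend_less_times_div[OF L, of k] by (simp add: n_def)
  let ?y = "cf_with_tail (map ?x [k..<L * n]) (X n)"
  have "[0..<L * n] = [0..<k] @ [k..<L * n]"
    using upt_add_eq_append[of 0 k "L * n - k"] k by (simp only: le_add_diff_inverse less_imp_le_nat le0)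
  then have "X 0 = cf_with_tail (map ?x [0..<k]) ?y"
    using start[of n] by (simp only: map_append cf_with_tail_append)
  moreover have "0 \<le> ?y"
    by (rule cf_with_tail_nonneg) (simp_all add: x1 X(1))
  moreover have "?y \<le> 1"
    by (rule cf_with_tail_le_1) (use k L in \<open>simp_all add: x1 X(1) n_def\<close>)
  ultimately show "\<exists>y. 0 \<le> y \<and> y \<le> 1 \<and> X 0 = cf_with_tail (map ?x [0..<k]) y"
    by blast
qed

section \<open>Moebius maps of the two halves of a block\<close>

text \<open>The last two conclusions are the premises of the next step, whose numerator is
  \<open>D\<close>, so steps chain by \<open>OF\<close>. With a minus sign, \<open>2 \<le> q\<close>
  keeps the numerator below the denominator.\<close>

lemma one_over_minus_step:
  fixes q N D :: real
  assumes "2 \<le> q" "0 < N" "N < D"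
  shows "1 / (q - N / D) = D / (q * D - N)" "0 < D" "D < q * D - N"
proof -
  show "0 < D" using assms by simp
  have "2 * D \<le> q * D" using assms by (intro mult_right_mono) auto
  then show "D < q * D - N" using assms by linarith
  then show "1 / (q - N / D) = D / (q * D - N)"
    using assms by (simp add: field_simps)
qed

lemma one_over_plus_step:
  fixes q N D :: real
  assumes "1 \<le> q" "0 < N" "N < D"
  shows "1 / (q + N / D) = D / (q * D + N)" "0 < D" "D < q * D + N"
proof -
  show D: "0 < D" using assms by simp
  have "1 * D \<le> q * D" using assms by (intro mult_right_mono) auto
  then show "D < q * D + N" using assms by linarith
  then show "1 / (q + N / D) = D / (q * D + N)"
    using assms D by (simp add: field_simps)
qed

text \<open>With \<open>x = b - 1 + s\<close> this is the identity
  \<open>1 / (1 + 1 / x) = 1 - 1 / (x + 1)\<close>.\<close>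

lemma cf_absorb_one:
  fixes a b s :: real
  assumes "0 < b - 1 + s"
  shows "1 / (a - 1 + 1 / (1 + 1 / (b - 1 + s))) = 1 / (a - 1 / (b + s))"
proof -
  have "1 / (1 + 1 / (b - 1 + s)) = 1 - 1 / (b + s)"
    using assms by (simp add: field_simps)
  then show ?thesis by simp
qed


text \<open>Seven steps from the inside out. The ratio of the coefficients of \<open>y\<close> is
  the convergent \<open>c\<close>, the limit as \<open>y\<close> tends to infinity.\<close>

lemma outer_word_value:
  fixes p q r y :: real
  assumes p: "2 \<le> p" and q: "2 \<le> q" and r: "2 \<le> r" and y: "1 < y"
  shows "1 / (r - 1 / (q + 1 / (r + 1 / (p - 1 / (r + 1 / (q - 1 / (r + 1 / y)))))))
    = ((1 + p * q * r^2 + p * q^2 * r^3) * y + p * (q * r + 1)^2)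
      / (p * q^2 * r^4 * y + (p * q^2 * r^3 + p * q * r^2 - 1))"
proof -
  have ge1: "1 \<le> q" "1 \<le> r" using q r by auto
  note s1 = one_over_plus_step[OF ge1(2) zero_less_one y]
  note s2 = one_over_minus_step[OF q s1(2,3)]
  note s3 = one_over_plus_step[OF ge1(2) s2(2,3)]
  note s4 = one_over_minus_step[OF p s3(2,3)]
  note s5 = one_over_plus_step[OF ge1(2) s4(2,3)]
  note s6 = one_over_plus_step[OF ge1(1) s5(2,3)]
  note s7 = one_over_minus_step[OF r s6(2,3)]
  show ?thesis
    unfolding s1(1) s2(1) s3(1) s4(1) s5(1) s6(1) s7(1)
    by (rule arg_cong2[where f = "(/)"]; simp add: eval_nat_numeral algebra_simps)
qed

text \<open>The signs between the quotients are those of the outer word read backwards. Compared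
  with the outer map, the two diagonal coefficients change places and \<open>w\<close> enters as
  \<open>- w\<close>.\<close>

lemma inner_word_value:
  fixes p q r w :: real
  assumes p: "2 \<le> p" and q: "2 \<le> q" and r: "2 \<le> r" and w: "1 < w"
  defines "N \<equiv> (p * q^2 * r^3 + p * q * r^2 - 1) * w - p * (q * r + 1)^2"
    and "D \<equiv> p * q^2 * r^4 * w - (1 + p * q * r^2 + p * q^2 * r^3)"
  shows "1 / (r - 1 / (q + 1 / (r - 1 / (p + 1 / (r + 1 / (q - 1 / (r - 1 / w))))))) = N / D"
    and "0 < N" and "N < D"
proof -
  have ge1: "1 \<le> q" "1 \<le> r" "1 \<le> p" using p q r by auto
  note s1 = one_over_minus_step[OF r zero_less_one w]
  note s2 = one_over_minus_step[OF q s1(2,3)]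
  note s3 = one_over_plus_step[OF ge1(2) s2(2,3)]
  note s4 = one_over_plus_step[OF ge1(3) s3(2,3)]
  note s5 = one_over_minus_step[OF r s4(2,3)]
  note s6 = one_over_plus_step[OF ge1(1) s5(2,3)]
  note s7 = one_over_minus_step[OF r s6(2,3)]
  \<comment> \<open>The left side is the denominator left by the sixth step; the seventh makes it
    the numerator.\<close>
  have N: "q * (r * (p * (r * (q * (r * w - 1) - w) + (r * w - 1)) + (q * (r * w - 1) - w))
      - (r * (q * (r * w - 1) - w) + (r * w - 1)))
    + (p * (r * (q * (r * w - 1) - w) + (r * w - 1)) + (q * (r * w - 1) - w)) = N"
    unfolding N_def by (simp add: eval_nat_numeral algebra_simps)
  then show "0 < N" using s7(2) by simp
  have D: "r * N - (r * (p * (r * (q * (r * w - 1) - w) + (r * w - 1)) + (q * (r * w - 1) - w))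
      - (r * (q * (r * w - 1) - w) + (r * w - 1))) = D"
    unfolding N_def D_def by (simp add: eval_nat_numeral algebra_simps)
  then show "N < D" using s7(3) unfolding N by simp
  show "1 / (r - 1 / (q + 1 / (r - 1 / (p + 1 / (r + 1 / (q - 1 / (r - 1 / w))))))) = N / D"
    unfolding s1(1) s2(1) s3(1) s4(1) s5(1) s6(1) using s7(1) unfolding N D .
qed

text \<open>The determinant identity \<open>Q * R = P * Q' + 1\<close> is used twice. It turns
  \<open>(P * y + R) / (Q * y + Q')\<close> into \<open>P / Q + 1 / (Q * (Q * y + Q'))\<close>. It
  also gives \<open>Q' * D - Q * N = 1\<close>, so at \<open>y = U - N / D\<close> the last
  denominator is \<open>Q^2 * U + Q / D\<close>, where \<open>Q / D = 1 / (w - c)\<close>.\<close>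

lemma both_words_value:
  fixes p q r U w :: real
  defines "Q \<equiv> p * q^2 * r^4" and "c \<equiv> 1 / (p * q^2 * r^4) + 1 / (q * r^2) + 1 / r"
  assumes p: "2 \<le> p" and q: "2 \<le> q" and r: "2 \<le> r" and w: "1 < w" and U: "2 \<le> U"
  shows "1 / (r - 1 / (q + 1 / (r + 1 / (p - 1 / (r + 1 / (q - 1 / (r + 1 / (U -
      1 / (r - 1 / (q + 1 / (r - 1 / (p + 1 / (r + 1 / (q - 1 / (r - 1 / w)))))))))))))))
    = c + 1 / (Q^2 * U + 1 / (w - c))"
proof -
  define P Q' R where "P = 1 + p * q * r^2 + p * q^2 * r^3"
    and "Q' = p * q^2 * r^3 + p * q * r^2 - 1" and "R = p * (q * r + 1)^2"
  define N D where "N = Q' * w - R" and "D = Q * w - P"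
  have ND: "0 < N" "N < D"
    and A: "1 / (r - 1 / (q + 1 / (r - 1 / (p + 1 / (r + 1 / (q - 1 / (r - 1 / w))))))) = N / D"
    using inner_word_value[OF p q r w]
    unfolding N_def D_def P_def Q'_def R_def Q_def by simp_all
  have det: "Q * R = P * Q' + 1"
    unfolding P_def Q'_def R_def Q_def by (simp add: eval_nat_numeral algebra_simps)
  have Q: "0 < Q" using p q r by (auto simp: Q_def)
  have c: "c = P / Q"
    unfolding c_def P_def Q_def using p q r by (simp add: field_simps power2_eq_square eval_nat_numeral)
  \<comment> \<open>The outer word is applied to \<open>U - N / D\<close>, which must exceed 1;
    \<open>2 \<le> U\<close> leaves just enough room.\<close>
  have "N / D < 1" using ND by simp
  then have y: "1 < U - N / D" using U by linarith
  have pos: "0 < Q * (U - N / D) + Q'"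
  proof -
    have "0 < p * q * r^2" "1 \<le> p * q^2 * r^3"
      using p q r by (auto intro!: mult_ge1_I one_le_power)
    then have "0 < Q'" by (simp add: Q'_def)
    then show ?thesis using Q y by (simp add: add_pos_pos)
  qed
  have "w - c = D / Q" using Q by (simp add: c D_def field_simps)
  then have "c + 1 / (Q^2 * U + 1 / (w - c)) = P / Q + 1 / (Q^2 * U + Q / D)"
    by (simp add: c)
  also have "Q^2 * U + Q / D = Q * (Q * (U - N / D) + Q')"
  proof -
    have "Q * N + 1 = Q' * D"
      unfolding N_def D_def using det by (simp add: algebra_simps)
    then show ?thesis
      using ND by (simp add: field_simps power2_eq_square) (metis distrib_left mult.left_commute mult.commute mult_1)
  qed
  also have "P / Q + 1 / (Q * (Q * (U - N / D) + Q'))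
      = (P * (U - N / D) + R) / (Q * (U - N / D) + Q')"
  proof -
    define Y where "Y = Q * (U - N / D) + Q'"
    have "P / Q + 1 / (Q * Y) = (P * Y + 1) / (Q * Y)"
      using Q pos[folded Y_def] by (simp add: field_simps)
    also have "P * Y + 1 = Q * (P * (U - N / D) + R)"
      unfolding Y_def using det by (simp add: algebra_simps)
    finally show ?thesis using Q by (simp add: Y_def)
  qed
  finally show ?thesis
    using outer_word_value[OF p q r y]
    unfolding A P_def Q'_def R_def Q_def by simp
qed

section \<open>A q-hypergeometric series and its contiguity relation\<close>

text \<open>The terms of the basic hypergeometric series 1phi1(0; -z; t, -l).\<close>

definition qser_term :: "real \<Rightarrow> real \<Rightarrow> real \<Rightarrow> nat \<Rightarrow> real" where
  "qser_term t l z n = l ^ n * t ^ (n * (n - 1) div 2) / (q_poch t t n * q_poch (- z) t n)"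

definition qser :: "real \<Rightarrow> real \<Rightarrow> real \<Rightarrow> real" where
  "qser t l z = (\<Sum>n. qser_term t l z n)"

lemma q_poch_0 [simp]: "q_poch z t 0 = 1"
  and q_poch_Suc: "q_poch z t (Suc n) = q_poch z t n * (1 - z * t ^ n)"
  by (simp_all add: q_poch_def)

lemma q_poch_Suc_left: "q_poch z t (Suc n) = (1 - z) * q_poch (z * t) t n"
  unfolding q_poch_def by (subst prod.lessThan_Suc_shift) (simp add: mult.assoc)

lemma q_poch_pos:
  assumes "0 \<le> t" "t < 1" "z < 1"
  shows "0 < q_poch z t n"
  unfolding q_poch_def
proof (rule prod_pos)
  fix k
  have "z * t ^ k < 1"
  proof (cases "0 \<le> z")
    case True
    then have "z * t ^ k \<le> z * 1"
      using assms by (intro mult_left_mono power_le_one) auto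
    then show ?thesis using assms by linarith
  next
    case False
    then have "z * t ^ k \<le> 0" using assms by (simp add: mult_nonpos_nonneg)
    then show ?thesis by linarith
  qed
  then show "0 < 1 - z * t ^ k" by simp
qed

lemma triangular_Suc: "Suc n * (Suc n - 1) div 2 = n * (n - 1) div 2 + n"
proof -
  have "Suc n * (Suc n - 1) = n * (n - 1) + n * 2" by (cases n) (auto simp: algebra_simps)
  then show ?thesis by (simp only: div_mult_self1[of 2] zero_neq_numeral not_False_eq_True)
qed

context
  fixes t l z :: real
  assumes t: "0 < t" "t < 1" and l: "0 < l" and z: "0 \<le> z"
begin

lemma qser_term_pos: "0 < qser_term t l z n"
  unfolding qser_term_def using t l z q_poch_pos[of t t n] q_poch_pos[of t "- z" n]
  by simp

lemma qser_term_Suc: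
  "qser_term t l z (Suc n) = qser_term t l z n * (l * t ^ n / ((1 - t ^ Suc n) * (1 + z * t ^ n)))"
  unfolding qser_term_def triangular_Suc q_poch_Suc
  by (simp add: power_add mult_ac)

text \<open>The ratio of consecutive terms carries the factor \<open>t ^ n\<close> and tends to
  0.\<close>

lemma summable_qser_term: "summable (qser_term t l z)"
proof -
  have pow: "(\<lambda>n. t ^ n) \<longlonglongrightarrow> 0" "(\<lambda>n. t ^ Suc n) \<longlonglongrightarrow> 0"
    by (intro LIMSEQ_Suc LIMSEQ_power_zero; use t in simp)+
  have "(\<lambda>n. l * t ^ n / ((1 - t ^ Suc n) * (1 + z * t ^ n))) \<longlonglongrightarrow> l * 0 / ((1 - 0) * (1 + z * 0))"
    by (intro tendsto_divide tendsto_mult tendsto_diff tendsto_add tendsto_const pow) auto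
  then have "eventually (\<lambda>n. l * t ^ n / ((1 - t ^ Suc n) * (1 + z * t ^ n)) < 1 / 2) sequentially"
    by (intro order_tendstoD(2)) auto
  then obtain N where N: "\<And>n. N \<le> n \<Longrightarrow> l * t ^ n / ((1 - t ^ Suc n) * (1 + z * t ^ n)) < 1 / 2"
    unfolding eventually_sequentially by blast
  show ?thesis
  proof (rule summable_ratio_test)
    fix n assume "N \<le> n"
    then have "qser_term t l z (Suc n) \<le> qser_term t l z n * (1 / 2)"
      unfolding qser_term_Suc using N[of n] qser_term_pos[of n] by (intro mult_left_mono) auto
    then show "norm (qser_term t l z (Suc n)) \<le> 1 / 2 * norm (qser_term t l z n)"
      using qser_term_pos[of n] qser_term_pos[of "Suc n"] by simp
  qed simp
qed

lemma qser_sums: "qser_term t l z sums qser t l z"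
  unfolding qser_def using summable_qser_term by (rule summable_sums)

lemma qser_pos: "0 < qser t l z"
  unfolding qser_def using summable_qser_term qser_term_pos by (rule suminf_pos)

lemma q_poch_shift: "(1 + z) * q_poch (- (z * t)) t n = q_poch (- z) t n * (1 + z * t ^ n)"
  using q_poch_Suc_left[of "- z" t n] q_poch_Suc[of "- z" t n] by simp

text \<open>\<open>(l * t) ^ n\<close> brings the factor \<open>t ^ n\<close>, and the shifted
  product differs from the old one only in its end factors \<open>1 + z\<close> and
  \<open>1 + z * t ^ n\<close>. Relations between shifts can thus be checked term by term.\<close>

lemma qser_term_shift:
  "qser_term t (l * t) (z * t) n * (1 + z * t ^ n) = (1 + z) * t ^ n * qser_term t l z n"
proof -
  define a b g x where "a = q_poch (- z) t n" and "b = q_poch (- (z * t)) t n"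
    and "g = q_poch t t n" and "x = 1 + z * t ^ n"
  have "- (z * t) < 1" using t z by (smt (verit) mult_nonneg_nonneg)
  then have pos: "0 < a" "0 < b" "0 < g"
    unfolding a_def b_def g_def using t z by (intro q_poch_pos; simp)+
  have abx: "(1 + z) * b = a * x"
    unfolding a_def b_def x_def by (rule q_poch_shift)
  have "x / b = (1 + z) / a"
    using pos abx by (metis frac_eq_eq mult.commute less_numeral_extra(3))
  have "qser_term t (l * t) (z * t) n * x = l ^ n * t ^ n * t ^ (n * (n - 1) div 2) / g * (x / b)"
    unfolding qser_term_def b_def[symmetric] g_def[symmetric] by (simp add: power_mult_distrib)
  also have "\<dots> = (1 + z) * t ^ n * qser_term t l z n"
    unfolding qser_term_def a_def[symmetric] g_def[symmetric] \<open>x / b = (1 + z) / a\<close>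
    by (simp add: mult_ac)
  finally show ?thesis unfolding x_def .
qed

end

text \<open>This bound makes the tails nonnegative. It holds termwise by the shift formula, as
  \<open>t ^ n \<le> 1 \<le> 1 + z * t ^ n\<close>.\<close>

lemma qser_shift_le:
  assumes t: "0 < t" "t < 1" and l: "0 < l" and z: "0 \<le> z"
  shows "qser t (l * t) (z * t) \<le> (1 + z) * qser t l z"
proof -
  have lt: "0 < l * t" "0 \<le> z * t" using t l z by auto
  have "qser_term t (l * t) (z * t) n \<le> (1 + z) * qser_term t l z n" for n
  proof -
    have T: "0 < qser_term t (l * t) (z * t) n" "0 < qser_term t l z n"
      using qser_term_pos[OF t lt] qser_term_pos[OF t l z] by auto
    have "qser_term t (l * t) (z * t) n * 1 \<le> qser_term t (l * t) (z * t) n * (1 + z * t ^ n)"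
      using T t z by (intro mult_left_mono) auto
    also have "\<dots> = (1 + z) * qser_term t l z n * t ^ n"
      using qser_term_shift[OF t l z, of n] by simp
    also have "\<dots> \<le> (1 + z) * qser_term t l z n * 1"
      using T t z by (intro mult_left_mono power_le_one) auto
    finally show ?thesis by simp
  qed
  then show ?thesis
    using sums_le[OF _ qser_sums[OF t lt] sums_mult[OF qser_sums[OF t l z]]] by blast
qed

text \<open>The relation holds term by term once the indices are staggered as in
  \<open>step\<close>: terms \<open>Suc n\<close> of the two \<open>1 + z\<close> series go with
  terms \<open>n\<close> of the other two. The split-off initial terms contribute
  \<open>1 + z\<close> on both sides.\<close>

lemma qser_recurrence:
  assumes t: "0 < t" "t < 1" and l: "0 < l" and z: "0 \<le> z"
  shows "(1 + z) * qser t l z + z * l * t / (1 + z * t) * qser t (l * t * t) (z * t * t)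
    = (1 + z + l) * qser t (l * t) (z * t)"
proof -
  let ?a = "qser_term t l z" and ?b = "qser_term t (l * t) (z * t)"
    and ?c = "qser_term t (l * t * t) (z * t * t)"
  have lt: "0 < l * t" "0 \<le> z * t" "0 < l * t * t" "0 \<le> z * t * t" using t l z by auto
  define zc where "zc = z * l * t / (1 + z * t)"
  have step: "(1 + z) * ?a (Suc n) + zc * ?c n = (1 + z) * ?b (Suc n) + l * ?b n" for n
  proof -
    have nz: "1 + z * t ^ n > 0" "1 + z * t * t ^ n > 0" "1 + z * t > 0" "1 + z > 0" "1 - t ^ Suc n > 0"
      using t z power_Suc_less_one[of t n] by (auto intro!: add_pos_nonneg)
    have a: "?a (Suc n) = ?a n * (l * t ^ n / ((1 - t ^ Suc n) * (1 + z * t ^ n)))"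
      by (rule qser_term_Suc[OF t l z])
    define G K W where "G = 1 + z * t ^ n" and "K = 1 - t ^ Suc n" and "W = 1 + z * t * t ^ n"
    have pos: "0 < G" "0 < K" "0 < W" using nz by (simp_all add: G_def K_def W_def)
    have b: "?b n * G = (1 + z) * t ^ n * ?a n"
      using qser_term_shift[OF t l z, of n] by (simp add: G_def)
    have b': "?b (Suc n) * W = (1 + z) * (t * t ^ n) * ?a (Suc n)"
      using qser_term_shift[OF t l z, of "Suc n"] by (simp add: W_def mult.assoc)
    have c: "?c n * W = (1 + z * t) * t ^ n * ?b n"
      using qser_term_shift[OF t lt(1,2), of n] by (simp add: W_def)
    have zc: "zc * (1 + z * t) = z * l * t"
      using nz by (simp add: zc_def)
    \<comment> \<open>Both \<open>?b n\<close> and \<open>?a (Suc n)\<close> are multiples of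
      \<open>?a n\<close>. Eliminating it, and clearing \<open>W\<close>, expresses all four
      summands through \<open>?a (Suc n)\<close>.\<close>
    have lb: "l * ?b n = (1 + z) * ?a (Suc n) * K"
    proof -
      have "l * ?b n * G = (1 + z) * (?a n * (l * t ^ n))"
        using b by (simp add: mult_ac)
      also have "\<dots> = (1 + z) * ?a (Suc n) * K * G"
        unfolding a G_def[symmetric] K_def[symmetric] using pos by simp
      finally show ?thesis using pos by simp
    qed
    have "((1 + z) * ?a (Suc n) + zc * ?c n) * W = (1 + z) * ?a (Suc n) * W + zc * (?c n * W)"
      by (simp add: algebra_simps)
    also have "zc * (?c n * W) = (zc * (1 + z * t)) * (t ^ n * ?b n)"
      unfolding c by (simp only: mult.assoc)
    also have "\<dots> = z * t * t ^ n * (l * ?b n)"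
      unfolding zc by (simp only: mult_ac)
    also have "(1 + z) * ?a (Suc n) * W + z * t * t ^ n * (l * ?b n)
        = (1 + z) * ((1 + z) * (t * t ^ n) * ?a (Suc n)) + l * ?b n * W"
      unfolding lb W_def K_def by (simp add: algebra_simps)
    also have "(1 + z) * (t * t ^ n) * ?a (Suc n) = ?b (Suc n) * W"
      using b' by simp
    finally have "((1 + z) * ?a (Suc n) + zc * ?c n) * W = ((1 + z) * ?b (Suc n) + l * ?b n) * W"
      by (simp add: algebra_simps)
    then show ?thesis using pos by simp
  qed
  have a0: "?a 0 = 1" "?b 0 = 1" by (simp_all add: qser_term_def)
  have A: "(\<lambda>n. ?a (Suc n)) sums (qser t l z - 1)"
    and B: "(\<lambda>n. ?b (Suc n)) sums (qser t (l * t) (z * t) - 1)"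
    using qser_sums[OF t l z] qser_sums[OF t lt(1,2)] unfolding sums_Suc_iff a0 by simp_all
  have "(\<lambda>n. (1 + z) * ?a (Suc n) + zc * ?c n)
      sums ((1 + z) * (qser t l z - 1) + zc * qser t (l * t * t) (z * t * t))"
    by (intro sums_add sums_mult A qser_sums[OF t lt(3,4)])
  moreover have "(\<lambda>n. (1 + z) * ?a (Suc n) + zc * ?c n)
      sums ((1 + z) * (qser t (l * t) (z * t) - 1) + l * qser t (l * t) (z * t))"
    unfolding step by (intro sums_add sums_mult B qser_sums[OF t lt(1,2)])
  ultimately have "(1 + z) * (qser t l z - 1) + zc * qser t (l * t * t) (z * t * t)
      = (1 + z) * (qser t (l * t) (z * t) - 1) + l * qser t (l * t) (z * t)"
    by (rule sums_unique2)
  then show ?thesis unfolding zc_def by (simp add: algebra_simps)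
qed

section \<open>Closed form of the unfolded continued fraction\<close>

text \<open>The closed form of \<open>[0; E u, f v, E u\<^sup>2, f v\<^sup>2, \<dots>]\<close>.
  Dropping two partial quotients amounts to replacing \<open>(E, f)\<close> by \<open>(E u, f v)\<close>.\<close>

definition tail_value :: "real \<Rightarrow> real \<Rightarrow> real \<Rightarrow> real \<Rightarrow> real" where
  "tail_value E f u v =
    (let t = 1 / (u * v); l = 1 / (E * f * u * v); z = 1 / (E * f * u^2 * v)
     in 1 / (E * u) - 1 / (E^2 * f * u^2 * v + E) * (qser t (l * t) (z * t) / qser t l z))"

text \<open>Since \<open>l = u * z\<close> and
  \<open>1 / (E^2 * f * u^2 * v + E) = z / (E * (1 + z))\<close>, the factor \<open>E * u\<close>
  turns the coefficient of the ratio into \<open>l / (1 + z)\<close>. Nonnegativity then follows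
  from \<open>H1 \<le> (1 + z) * H0\<close> and \<open>l \<le> 1\<close>.\<close>

lemma tail_value:
  fixes E f u v :: real
  assumes E: "1 \<le> E" and f: "1 \<le> f" and u: "1 < u" and v: "1 < v"
  shows tail_value_nonneg: "0 \<le> tail_value E f u v"
    and tail_value_times: "tail_value E f u v * (E * u) = 1 - (1 / (E * f * u * v))
        / (1 + 1 / (E * f * u^2 * v))
        * (qser (1 / (u * v)) (1 / (E * f * u * v) * (1 / (u * v))) (1 / (E * f * u^2 * v) * (1 / (u * v)))
        / qser (1 / (u * v)) (1 / (E * f * u * v)) (1 / (E * f * u^2 * v)))"
proof -
  define t l z where "t = 1 / (u * v)" and "l = 1 / (E * f * u * v)" and "z = 1 / (E * f * u^2 * v)"
  have uv: "1 < u * v" using u v less_1_mult by blast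
  have Efuv: "1 * 1 \<le> (E * f) * (u * v)"
    using E f uv mult_mono[of 1 E 1 f] by (intro mult_mono) auto
  have t: "0 < t" "t < 1" using uv by (auto simp: t_def)
  have l: "0 < l" "l \<le> 1" using E f u v Efuv by (auto simp: l_def mult.assoc)
  have z: "0 < z" "l = u * z" using E f u v by (auto simp: z_def l_def power2_eq_square)
  define H0 H1 where "H0 = qser t l z" and "H1 = qser t (l * t) (z * t)"
  have H: "0 < H0" "H1 \<le> (1 + z) * H0"
    using qser_pos[OF t l(1)] qser_shift_le[OF t l(1)] z by (simp_all add: H0_def H1_def)
  have coeff: "1 / (E^2 * f * u^2 * v + E) = z / (E * (1 + z))"
  proof -
    have "E^2 * f * u^2 * v + E = E * (1 + z) / z"
      using E f u v by (simp add: z_def power2_eq_square field_simps)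
    then show ?thesis by simp
  qed
  have "tail_value E f u v = 1 / (E * u) - z / (E * (1 + z)) * (H1 / H0)"
    unfolding tail_value_def Let_def coeff t_def[symmetric] l_def[symmetric] z_def[symmetric]
      H0_def H1_def ..
  then have alt: "tail_value E f u v * (E * u) = 1 - l / (1 + z) * (H1 / H0)"
    unfolding z(2) using E u z by (simp add: left_diff_distrib)
  then show "tail_value E f u v * (E * u) = 1 - (1 / (E * f * u * v))
        / (1 + 1 / (E * f * u^2 * v))
        * (qser (1 / (u * v)) (1 / (E * f * u * v) * (1 / (u * v))) (1 / (E * f * u^2 * v) * (1 / (u * v)))
        / qser (1 / (u * v)) (1 / (E * f * u * v)) (1 / (E * f * u^2 * v)))"
    unfolding H0_def H1_def t_def l_def z_def .
  have "H1 / H0 \<le> 1 + z" using H by (simp add: divide_le_eq)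
  then have "l / (1 + z) * (H1 / H0) \<le> l / (1 + z) * (1 + z)"
    using l z by (intro mult_left_mono) auto
  then have "0 \<le> tail_value E f u v * (E * u)"
    unfolding alt using l z by simp
  moreover have "0 < E * u" using E u by simp
  ultimately show "0 \<le> tail_value E f u v" by (simp add: zero_le_mult_iff)
qed

text \<open>Dividing the contiguity relation by \<open>l * H1\<close> shows that
  \<open>l / (1 + z) * (H1 / H0)\<close> has reciprocal \<open>1 + E * u * Y\<close>. Hence
  \<open>T * (E * u) = 1 - 1 / (1 + E * u * Y)\<close>, which is the continued fraction
  step.\<close>

lemma tail_value_step:
  fixes E f u v :: real
  assumes E: "1 \<le> E" and f: "1 \<le> f" and u: "1 < u" and v: "1 < v"
  shows "tail_value E f u v = 1 / (E * u + 1 / (f * v + tail_value (E * u) (f * v) u v))"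
proof -
  define t l z where "t = 1 / (u * v)" and "l = 1 / (E * f * u * v)" and "z = 1 / (E * f * u^2 * v)"
  have t: "0 < t" "t < 1" using u v less_1_mult by (auto simp: t_def)
  have l: "0 < l" using E f u v by (auto simp: l_def)
  have z: "0 < z" "l = u * z" using E f u v by (auto simp: z_def l_def power2_eq_square)
  \<comment> \<open>Passing to \<open>(E * u, f * v)\<close> multiplies \<open>E * f\<close> by
    \<open>u * v = 1 / t\<close>, while \<open>t\<close> itself stays fixed.\<close>
  have lt: "1 / ((E * u) * (f * v) * u * v) = l * t" "1 / ((E * u) * (f * v) * u^2 * v) = z * t"
    by (simp_all add: l_def z_def t_def)
  have Eu: "1 \<le> E * u" "1 \<le> f * v"
    using E f u v mult_mono[of 1 E 1 u] mult_mono[of 1 f 1 v] by auto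
  define H0 H1 H2 where "H0 = qser t l z" and "H1 = qser t (l * t) (z * t)"
    and "H2 = qser t (l * t * t) (z * t * t)"
  have H: "0 < H0" "0 < H1"
    using qser_pos[OF t, of l z] qser_pos[OF t, of "l * t" "z * t"] t l z by (simp_all add: H0_def H1_def)
  define T T' where "T = tail_value E f u v" and "T' = tail_value (E * u) (f * v) u v"
  define Y where "Y = f * v + T'"
  have Y: "0 < Y"
    using tail_value_nonneg[OF Eu u v] Eu by (simp add: Y_def T'_def)
  have T: "T * (E * u) = 1 - l / (1 + z) * (H1 / H0)"
    using tail_value_times[OF assms] unfolding T_def H0_def H1_def t_def l_def z_def .
  have "T' * (E * u * u) = 1 - l * t / (1 + z * t) * (H2 / H1)"
    using tail_value_times[OF Eu u v] unfolding lt t_def[symmetric] T'_def H1_def H2_def .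
  then have "T' * (E * u) = (1 - u * (z * t / (1 + z * t)) * (H2 / H1)) / u"
    using u z by (simp add: field_simps)
  then have T': "T' * (E * u) = 1 / u - z * t / (1 + z * t) * (H2 / H1)"
    using u by (simp add: diff_divide_distrib)
  have fv: "f * v * (E * u) = 1 / l" by (simp add: l_def mult_ac)
  have Yeq: "E * u * Y = 1 / l + 1 / u - z * t / (1 + z * t) * (H2 / H1)"
    using T' fv by (simp add: Y_def algebra_simps)
  have "(1 + z) * H0 = (1 + z + l) * H1 - z * l * t / (1 + z * t) * H2"
    using qser_recurrence[OF t l, of z] z by (simp add: H0_def H1_def H2_def)
  then have "(1 + z) * H0 = l * H1 * ((1 + z + l) / l - z * t / (1 + z * t) * (H2 / H1))"
    using l H by (simp add: right_diff_distrib)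
  also have "(1 + z + l) / l = 1 / l + 1 / u + 1"
    using z u by (simp add: add_divide_distrib)
  also have "1 / l + 1 / u + 1 - z * t / (1 + z * t) * (H2 / H1) = 1 + E * u * Y"
    using Yeq by simp
  finally have "(1 + z) * H0 = l * H1 * (1 + E * u * Y)" .
  moreover have "l / (1 + z) * (H1 / H0) = l * H1 / ((1 + z) * H0)" by simp
  ultimately have rho: "l / (1 + z) * (H1 / H0) = 1 / (1 + E * u * Y)"
    using H l by simp
  have "0 < 1 + E * u * Y" using Y E u by (simp add: add_pos_pos)
  then have "T * (E * u) = Y * (E * u) / (1 + E * u * Y)"
    unfolding T rho by (simp add: field_simps)
  moreover have "E * u \<noteq> 0" using E u by simp
  ultimately have "T = Y / (1 + E * u * Y)"
    by (metis mult_right_cancel times_divide_eq_left)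
  also have "\<dots> = 1 / (E * u + 1 / Y)"
    using Y by (simp add: field_simps)
  finally show ?thesis unfolding T_def Y_def T'_def .
qed

section \<open>Rewriting a block with minus signs\<close>

lemma cf_with_tail_Cons_eq:
  "cf_with_tail as y = T \<Longrightarrow> cf_with_tail (a # as) y = 1 / (of_int a + T)"
  by simp

text \<open>The decrements are equational premises so that literal entries unify, for instance
  \<open>b = r - 2\<close> with \<open>b' = r - 1\<close>.\<close>

lemma cf_with_tail_absorb_one:
  assumes "cf_with_tail (b' # as) y = T"
    and "b = b' - 1" "a = a' - 1" "2 \<le> b'" "\<forall>a\<in>set as. 1 \<le> a" "0 \<le> y"
  shows "cf_with_tail (a # 1 # b # as) y = 1 / (of_int a' - T)"
  using cf_absorb_one[of "of_int b'" "cf_with_tail as y" "of_int a'"]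
    cf_with_tail_nonneg[OF assms(5,6)] assms by simp

text \<open>The block is built from its right end. An entry between two ones is decremented from
  both sides, which accounts for \<open>r - 2\<close>; \<open>3 \<le> r\<close> keeps it
  positive.\<close>

lemma block_unfold:
  fixes p q r U V :: int and y :: real
  assumes "2 \<le> p" "2 \<le> q" "3 \<le> r" "2 \<le> U" "2 \<le> V" "0 \<le> y"
  shows "cf_with_tail [r - 1, 1, q - 1, r, p - 1, 1, r - 1, q - 1, 1, r - 1, U - 1, 1,
       r - 2, 1, q - 1, r - 1, 1, p - 1, r, q - 1, 1, r - 2, 1, V - 1] y
    = 1 / (r - 1 / (q + 1 / (r + 1 / (p - 1 / (r + 1 / (q - 1 / (r + 1 / (U -
      1 / (r - 1 / (q + 1 / (r - 1 / (p + 1 / (r + 1 / (q - 1 / (r - 1 / (V + y))))))))))))))))"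
proof -
  note plus = cf_with_tail_Cons_eq and minus = cf_with_tail_absorb_one
  \<comment> \<open>The start is \<open>[V]\<close> rather than \<open>[V - 1]\<close>: absorbing
    the 1 in front of it performs the decrement.\<close>
  have "cf_with_tail [V] y = 1 / (V + y)" by simp
  then have "cf_with_tail [r - 1, 1, V - 1] y = 1 / (r - 1 / (V + y))" (is "_ = ?T1")
    by (rule minus) (use assms in simp_all)
  then have "cf_with_tail [q - 1, 1, r - 2, 1, V - 1] y = 1 / (q - ?T1)"
    by (rule minus) (use assms in simp_all)
  note plus[of _ _ _ p, OF plus[of _ _ _ r, OF this]]
  then have "cf_with_tail [r - 1, 1, p - 1, r, q - 1, 1, r - 2, 1, V - 1] y
      = 1 / (r - 1 / (p + 1 / (r + 1 / (q - ?T1))))" (is "_ = ?T2")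
    by (rule minus) (use assms in simp_all)
  note plus[of _ _ _ q, OF this]
  then have "cf_with_tail [r - 1, 1, q - 1, r - 1, 1, p - 1, r, q - 1, 1, r - 2, 1, V - 1] y
      = 1 / (r - 1 / (q + ?T2))" (is "_ = ?T3")
    by (rule minus) (use assms in simp_all)
  then have "cf_with_tail [U - 1, 1, r - 2, 1, q - 1, r - 1, 1, p - 1, r, q - 1, 1, r - 2, 1, V - 1] y
      = 1 / (U - ?T3)"
    by (rule minus) (use assms in simp_all)
  note plus[of _ _ _ r, OF this]
  then have "cf_with_tail [q - 1, 1, r - 1, U - 1, 1, r - 2, 1, q - 1, r - 1, 1, p - 1, r, q - 1, 1,
      r - 2, 1, V - 1] y = 1 / (q - 1 / (r + 1 / (U - ?T3)))" (is "_ = ?T4")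
    by (rule minus) (use assms in simp_all)
  note plus[of _ _ _ r, OF this]
  then have "cf_with_tail [p - 1, 1, r - 1, q - 1, 1, r - 1, U - 1, 1, r - 2, 1, q - 1, r - 1, 1,
      p - 1, r, q - 1, 1, r - 2, 1, V - 1] y = 1 / (p - 1 / (r + ?T4))"
    by (rule minus) (use assms in simp_all)
  note plus[of _ _ _ q, OF plus[of _ _ _ r, OF this]]
  then show ?thesis
    by (rule minus) (use assms in simp_all)
qed

section \<open>Assembly of the value\<close>

text \<open>The surplus over the exponent in \<open>qser_term\<close> is the power of
  \<open>t\<close> inside \<open>l ^ n\<close> and \<open>(l * t) ^ n\<close> respectively.\<close>

lemma triangular_add:
  fixes n :: nat
  shows "n * (n + 1) div 2 = n * (n - 1) div 2 + n"
    and "n * (n + 3) div 2 = n * (n - 1) div 2 + 2 * n"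
proof -
  have "n * (n + 1) = n * (n - 1) + n * 2" "n * (n + 3) = n * (n - 1) + (2 * n) * 2"
    by (cases n; simp add: algebra_simps)+
  then show "n * (n + 1) div 2 = n * (n - 1) div 2 + n" "n * (n + 3) div 2 = n * (n - 1) div 2 + 2 * n"
    by (simp_all only: div_mult_self1[of 2] zero_neq_numeral not_False_eq_True)
qed

text \<open>The quotient of series multiplies only the second fraction. The truncation
  \<open>[0; E u, f v] = 1 / (E u) - 1 / (E^2 f u^2 v + E u)\<close> shows the same shape.\<close>

theorem theorem12:
  fixes e f p q r u v E :: int
  assumes "e > 0" and "f > 0" and "p > 1" and "q > 1" and "r > 2" and "u > 1" and "v > 1"
    and "E = e * p ^ 2 * q ^ 4 * r ^ 8"
  shows "cf_has_value
    (concat_blocks 24 (\<lambda>n.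
      [r - 1, 1, q - 1, r, p - 1, 1, r - 1, q - 1, 1, r - 1, e * u ^ n - 1, 1,
       r - 2, 1, q - 1, r - 1, 1, p - 1, r, q - 1, 1, r - 2, 1, f * v ^ n - 1]))
    (1 / real_of_int (p * q ^ 2 * r ^ 4) + 1 / real_of_int (q * r ^ 2) + 1 / real_of_int r
     + (1 / real_of_int (E * u)
        - 1 / real_of_int (E ^ 2 * f * u ^ 2 * v + E)
          * ((\<Sum>n. real_of_int (E * f) powi (- int n)
                   * real_of_int (u * v) powi (- int (n * (n + 3) div 2))
                   / (q_poch (1 / real_of_int (u * v)) (1 / real_of_int (u * v)) n
                      * q_poch (- 1 / real_of_int (E * f * u ^ 3 * v ^ 2)) (1 / real_of_int (u * v)) n))
             / (\<Sum>n. real_of_int (E * f) powi (- int n)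
                   * real_of_int (u * v) powi (- int (n * (n + 1) div 2))
                   / (q_poch (1 / real_of_int (u * v)) (1 / real_of_int (u * v)) n
                      * q_poch (- 1 / real_of_int (E * f * u ^ 2 * v)) (1 / real_of_int (u * v)) n)))))"
proof -
  define e' f' p' q' r' u' v' E' :: real
    where "e' = of_int e" and "f' = of_int f" and "p' = of_int p" and "q' = of_int q"
      and "r' = of_int r" and "u' = of_int u" and "v' = of_int v" and "E' = of_int E"
  note real_defs = e'_def f'_def p'_def q'_def r'_def u'_def v'_def E'_def
  \<comment> \<open>This form of \<open>E\<close> absorbs the square that the unfolding puts in
    front of \<open>e * u ^ Suc n\<close>.\<close>
  have E: "E' = e' * (p' * q'^2 * r'^4)^2"
    using assms(8) by (simp add: real_defs power_mult_distrib flip: power_mult)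
  have "1 \<le> E"
    unfolding assms(8) using assms(1-7) by (simp add: int_one_le_iff_zero_less)
  then have ge1: "1 \<le> E'" "1 \<le> f'" "1 < u'" "1 < v'"
    using assms(2,6,7) by (auto simp: real_defs)
  define c where "c = 1 / (p' * q'^2 * r'^4) + 1 / (q' * r'^2) + 1 / r'"
  \<comment> \<open>The tail after \<open>n\<close> blocks. The first quotient in
    \<open>tail_value E f u v\<close> is \<open>E * u\<close>, so the power \<open>u' ^ n\<close>
    here matches block \<open>Suc n\<close>.\<close>
  define X where "X n = c + tail_value (E' * u' ^ n) (f' * v' ^ n) u' v'" for n
  let ?B = "\<lambda>n. [r - 1, 1, q - 1, r, p - 1, 1, r - 1, q - 1, 1, r - 1, e * u ^ n - 1, 1,
       r - 2, 1, q - 1, r - 1, 1, p - 1, r, q - 1, 1, r - 2, 1, f * v ^ n - 1]"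
  have scaled_ge1: "1 \<le> E' * u' ^ n" "1 \<le> f' * v' ^ n" for n
    using ge1 mult_mono[of 1 E' 1 "u' ^ n"] mult_mono[of 1 f' 1 "v' ^ n"] one_le_power[of u' n] one_le_power[of v' n]
    by auto
  have tail_nonneg: "0 \<le> tail_value (E' * u' ^ n) (f' * v' ^ n) u' v'" for n
    using tail_value_nonneg[OF scaled_ge1 ge1(3,4)] .
  have c_nonneg: "0 < c"
    using assms(3-5) by (simp add: c_def real_defs add_pos_pos)
  have X_nonneg: "0 \<le> X n" for n
    using tail_nonneg[of n] c_nonneg by (simp add: X_def)
  have UV: "2 \<le> e * u ^ Suc n" "2 \<le> f * v ^ Suc n" for n
  proof -
    have "2 \<le> a * b ^ Suc n" if "0 < a" "1 < b" for a b :: int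
    proof -
      have "1 * (2 * 1) \<le> a * (b * b ^ n)"
        using that by (intro mult_mono) (auto simp: one_le_power)
      then show ?thesis by simp
    qed
    then show "2 \<le> e * u ^ Suc n" "2 \<le> f * v ^ Suc n" using assms by auto
  qed
  have X_step: "X n = cf_with_tail (?B (Suc n)) (X (Suc n))" for n
  proof -
    define U V where "U = e * u ^ Suc n" and "V = f * v ^ Suc n"
    define w where "w = of_int V + X (Suc n)"
    have U: "2 \<le> U" and V: "2 \<le> V" using UV[of n] unfolding U_def V_def by blast+
    have w: "1 < w" using V X_nonneg[of "Suc n"] by (simp add: w_def)
    have "cf_with_tail (?B (Suc n)) (X (Suc n)) = c + 1 / ((p' * q'^2 * r'^4)^2 * U + 1 / (w - c))"
      unfolding U_def[symmetric] V_def[symmetric] w_def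
      using trans[OF block_unfold[OF _ _ _ U V X_nonneg[of "Suc n"], of p q r]
          both_words_value[of p' q' r' w U, unfolded real_defs w_def]] assms(3-5) w U
      by (simp add: real_defs w_def c_def del: cf_with_tail.simps)
    also have "(p' * q'^2 * r'^4)^2 * U = E' * u' ^ n * u'"
      by (simp add: E U_def real_defs)
    also have "w - c = f' * v' ^ n * v' + tail_value (E' * u' ^ n * u') (f' * v' ^ n * v') u' v'"
      by (simp add: w_def V_def X_def real_defs mult_ac)
    \<comment> \<open>The unfolded block acts on \<open>X - c\<close> as two quotients of the closed
      form.\<close>
    also have "1 / (E' * u' ^ n * u' + 1 / \<dots>) = tail_value (E' * u' ^ n) (f' * v' ^ n) u' v'"
      using tail_value_step[OF scaled_ge1[of n] ge1(3,4)] by simp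
    finally show ?thesis by (simp only: X_def)
  qed
  have "cf_has_value (concat_blocks 24 ?B) (X 0)"
  proof (rule cf_has_value_concat_blocks)
    show "\<forall>a\<in>set (?B (Suc n)). 1 \<le> a" for n
      using assms UV[of n] by auto
      show "0 \<le> X n" for n by (rule X_nonneg)
    show "X n = cf_with_tail (?B (Suc n)) (X (Suc n))" for n by (rule X_step)
  qed simp_all
  moreover have "X 0 = 1 / real_of_int (p * q ^ 2 * r ^ 4) + 1 / real_of_int (q * r ^ 2) + 1 / real_of_int r
     + (1 / real_of_int (E * u)
        - 1 / real_of_int (E ^ 2 * f * u ^ 2 * v + E)
          * ((\<Sum>n. real_of_int (E * f) powi (- int n)
                   * real_of_int (u * v) powi (- int (n * (n + 3) div 2))
                   / (q_poch (1 / real_of_int (u * v)) (1 / real_of_int (u * v)) n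
                      * q_poch (- 1 / real_of_int (E * f * u ^ 3 * v ^ 2)) (1 / real_of_int (u * v)) n))
             / (\<Sum>n. real_of_int (E * f) powi (- int n)
                   * real_of_int (u * v) powi (- int (n * (n + 1) div 2))
                   / (q_poch (1 / real_of_int (u * v)) (1 / real_of_int (u * v)) n
                      * q_poch (- 1 / real_of_int (E * f * u ^ 2 * v)) (1 / real_of_int (u * v)) n))))"
    (is "_ = ?c + (1 / ?d - 1 / ?g * (?num / ?den))")
  proof -
    define t l z where "t = 1 / (u' * v')" and "l = 1 / (E' * f' * u' * v')" and "z = 1 / (E' * f' * u'^2 * v')"
    have t_int: "1 / real_of_int (u * v) = t" by (simp add: t_def real_defs)
    have pow_int: "real_of_int (E * f) powi (- int n) = (1 / (E' * f')) ^ n"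
      "real_of_int (u * v) powi (- int n) = t ^ n" for n
      by (simp_all add: t_def real_defs power_int_minus power_one_over inverse_eq_divide)
    have z_int: "- 1 / real_of_int (E * f * u ^ 3 * v ^ 2) = - (z * t)"
      "- 1 / real_of_int (E * f * u ^ 2 * v) = - z"
      by (simp_all add: t_def z_def real_defs power2_eq_square power3_eq_cube mult_ac)
    \<comment> \<open>The stated series keep powers of \<open>E * f\<close> and \<open>u * v\<close>
      apart, so \<open>l\<close> is split in the same way.\<close>
    have l: "l = 1 / (E' * f') * t" by (simp add: l_def t_def mult_ac)
    have l_pow: "l ^ n = (1 / (E' * f')) ^ n * t ^ n" "(l * t) ^ n = (1 / (E' * f')) ^ n * t ^ (2 * n)" for n
      unfolding l by (simp_all only: power_mult_distrib mult_2 power_add mult.assoc)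
    have "?num = qser t (l * t) (z * t)"
      unfolding qser_def t_int pow_int z_int qser_term_def triangular_add(2) l_pow
      by (simp only: power_add mult_ac)
    moreover have "?den = qser t l z"
      unfolding qser_def t_int pow_int z_int qser_term_def triangular_add(1) l_pow
      by (simp only: power_add mult_ac)
    moreover have "?c = c" by (simp add: c_def real_defs)
    ultimately show ?thesis
      by (simp add: X_def tail_value_def Let_def t_def[symmetric] l_def[symmetric] z_def[symmetric])
        (simp add: real_defs)
  qed
  ultimately show ?thesis by simp
qed

end
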